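(* Let $k,r\ge2$ be integers, let $\Gamma$ be the symmetric graph of type $k$ and order $r$ with vertex set $\mathcal V$, and put $Q=(r-1)(k-1)$. For all $2\le p,\tilde p<\infty$, there exists $C>0$ such that, for all $f\in\mathcal D(\mathcal V)$ and all radial $\chi\in\mathcal D(\mathcal V)^{\sharp}$, $$\|f*\chi\|_{L^p(\mathcal V)}\le C\,\|f\|_{L^{\tilde p'}(\mathcal V)}\Big\{\sum_{n\ge0}|\chi(n)|^{\rho}\,(1+n)^{2s}\,Q^{(1+s)n}\Big\}^{\frac1\rho},$$ where $\rho=\frac{p\,\tilde p}{p+\tilde p}$, $s=\frac{\min\{p,\tilde p\}}{p+\tilde p}$, and $\tilde p'$ is the conjugate exponent of $\tilde p$.
   Context: Symmetric graph: $\Gamma$ is a connected graph in which every vertex $v$ belongs to exactly $r$ polygons with $k$ sides each (for $k=2$ a polygon is a single edge), these polygons having no side and no vertex in common except $v$, and such that every nontrivial loop runs through all the edges of at least one polygon. $\mathcal V$ is its vertex set, identified with a group $G$ acting isometrically and simply transitively on $\Gamma$. The distance $d(x,y)$ is the minimal number of polygons crossed by a path connecting $x$ with $y$. Fix an origin $o\in\mathcal V$ and put $|x|=d(x,o)$. $L^p(\mathcal V)$ is taken with respect to counting measure. $\mathcal D(\mathcal V)$ is the space of finitely supported complex functions; a function is radial if it depends only on $|x|$, and then $\chi(n)$ is its value at $|x|=n$; $\mathcal D(\mathcal V)^{\sharp}$ is the space of finitely supported radial functions. For $\chi$ radial, the convolution $f*\chi(x)=\sum_{y\in G}f(y)\chi(y^{-1}x)$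 equals $\sum_{n\in\mathbb N}\chi(n)\sum_{y:\,d(x,y)=n}f(y)$. *)

theory Defs
  imports
    "HOL-Analysis.Analysis"
    "HOL-Algebra.Group_Action"
    "Graph_Theory.Graph_Theory"
begin

text \<open>
  Graphs are symmetric loop-free pair digraphs: an edge joining \<open>x\<close> and \<open>y\<close> is the pair of arcs
  \<open>(x, y)\<close>, \<open>(y, x)\<close>. A polygon is the set of all arcs, in both directions, of a cycle
  of length \<open>k\<close>. For \<open>k = 2\<close> the cycles of length 2 are \<open>[(x, y), (y, x)]\<close>, so a polygon is then
  a single edge.
\<close>

definition (in pair_pre_digraph) polygons :: "nat \<Rightarrow> ('a \<times> 'a) set set" where
  "polygons k = {set c \<union> (set c)\<inverse> | c. cycle c \<and> length c = k}"

definition polygon_verts :: "('a \<times> 'a) set \<Rightarrow> 'a set" where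
  "polygon_verts P = fst ` P"

text \<open>A loop is nontrivial if it is nonempty and has no backtracking.\<close>

definition (in pair_pre_digraph) nontrivial_loop :: "('a \<times> 'a) list \<Rightarrow> bool" where
  "nontrivial_loop p \<longleftrightarrow>
     p \<noteq> [] \<and> (\<exists>u. awalk u p u) \<and> successively (\<lambda>e e'. e' \<noteq> prod.swap e) p"

text \<open>
  In \<open>loop_polygon\<close> the loop has to run through the \<open>k\<close> sides of a polygon as oriented by a cycle
  \<open>c\<close>. For \<open>k \<ge> 3\<close> one may equivalently ignore orientations, since every
  nontrivial loop has a simple cycle of length at least 3 as a contiguous part. For \<open>k = 2\<close> the two
  sides are the two directions of one edge; ignoring orientations would make the condition void and
  would admit, for instance, the pentagon as a graph of type 2 and order 2, whereas the graph meant
  is the homogeneous tree of degree \<open>r\<close>.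

  The condition \<open>edge_polygon\<close> expresses that the graph is made up of its polygons. Without it,
  bridges lying in no polygon could be added at each vertex.
\<close>

locale symmetric_graph = pair_bidirected_digraph \<Gamma>
  for \<Gamma> :: "'a pair_pre_digraph" and k r :: nat +
  assumes connected: "Digraph_Component.connected (with_proj \<Gamma>)"
    and card_polygons: "v \<in> pverts \<Gamma> \<Longrightarrow> card {P \<in> polygons k. v \<in> polygon_verts P} = r"
    and polygons_meet:
      "\<lbrakk>P \<in> polygons k; P' \<in> polygons k; P \<noteq> P'; v \<in> polygon_verts P; v \<in> polygon_verts P'\<rbrakk>
        \<Longrightarrow> P \<inter> P' = {} \<and> polygon_verts P \<inter> polygon_verts P' = {v}"
    and edge_polygon: "e \<in> parcs \<Gamma> \<Longrightarrow> \<exists>P \<in> polygons k. e \<in> P"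
    and loop_polygon: "nontrivial_loop p \<Longrightarrow> \<exists>c. cycle c \<and> length c = k \<and> set c \<subseteq> set p"

text \<open>A polygon is crossed by a walk if the walk runs along one of its sides.\<close>

definition (in pair_pre_digraph) polygon_dist :: "nat \<Rightarrow> 'a \<Rightarrow> 'a \<Rightarrow> nat" where
  "polygon_dist k x y =
     (LEAST n. \<exists>p. awalk x p y \<and> n = card {P \<in> polygons k. P \<inter> set p \<noteq> {}})"

locale symmetric_graph_group =
  symmetric_graph \<Gamma> k r + transitive_action G "pverts \<Gamma>" \<phi>
  for \<Gamma> :: "'a pair_pre_digraph" and k r :: nat
    and G :: "('g, 'm) monoid_scheme" (structure) and \<phi> :: "'g \<Rightarrow> 'a \<Rightarrow> 'a" +
  assumes simply_transitive:
      "\<lbrakk>x \<in> pverts \<Gamma>; y \<in> pverts \<Gamma>\<rbrakk> \<Longrightarrow> \<exists>!g. g \<in> carrier G \<and> \<phi> g x = y"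
    and isometric: "\<lbrakk>g \<in> carrier G; x \<in> pverts \<Gamma>; y \<in> pverts \<Gamma>\<rbrakk>
        \<Longrightarrow> polygon_dist k (\<phi> g x) (\<phi> g y) = polygon_dist k x y"

definition (in pair_pre_digraph) radial :: "nat \<Rightarrow> 'a \<Rightarrow> ('a \<Rightarrow> complex) \<Rightarrow> bool" where
  "radial k orig h \<longleftrightarrow>
     (\<forall>x \<in> pverts G. \<forall>y \<in> pverts G.
        polygon_dist k x orig = polygon_dist k y orig \<longrightarrow> h x = h y)"

definition (in pair_pre_digraph) radial_value ::
    "nat \<Rightarrow> 'a \<Rightarrow> ('a \<Rightarrow> complex) \<Rightarrow> nat \<Rightarrow> complex" where
  "radial_value k orig h n = h (SOME x. x \<in> pverts G \<and> polygon_dist k x orig = n)"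

text \<open>
  The group element \<open>y\<close> is identified with the vertex \<open>\<phi> y orig\<close>. Under this identification
  \<open>y\<inverse>x\<close> becomes \<open>\<phi> (inv y) x\<close> for a vertex \<open>x\<close>.
\<close>

definition convolution :: "('g, 'm) monoid_scheme \<Rightarrow> ('g \<Rightarrow> 'a \<Rightarrow> 'a) \<Rightarrow> 'a
    \<Rightarrow> ('a \<Rightarrow> complex) \<Rightarrow> ('a \<Rightarrow> complex) \<Rightarrow> 'a \<Rightarrow> complex" where
  "convolution G \<phi> orig f h x = (\<Sum>\<^sub>\<infinity>y \<in> carrier G. f (\<phi> y orig) * h (\<phi> (inv\<^bsub>G\<^esub> y) x))"

definition finite_support :: "'a set \<Rightarrow> ('a \<Rightarrow> complex) \<Rightarrow> bool" where
  "finite_support V f \<longleftrightarrow> finite {x \<in> V. f x \<noteq> 0}"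

definition Lp_norm :: "'a set \<Rightarrow> real \<Rightarrow> ('a \<Rightarrow> complex) \<Rightarrow> real" where
  "Lp_norm V p f = (\<integral>x. norm (f x) powr p \<partial>count_space V) powr (1 / p)"

end

theory Submission
  imports Defs
begin

text \<open>
  Since \<open>1 / \<rho> = 1 / p + 1 / q\<close>, Young's inequality on the discrete group gives
  \<open>\<parallel>f * \<chi>\<parallel>\<^sub>p \<le> \<parallel>f\<parallel>\<^sub>q\<^sub>' \<parallel>\<chi>\<parallel>\<^sub>\<rho>\<close>. A vertex at distance \<open>n + 1\<close> from the origin is reached from one at
  distance \<open>n\<close> by crossing one further polygon, so the sphere of radius \<open>n\<close> has at most
  \<open>r (k - 1) Q\<^sup>n\<close> points, and \<open>Q\<^sup>n \<le> (1 + n)\<^sup>2\<^sup>s Q\<^sup>(\<^sup>1\<^sup>+\<^sup>s\<^sup>)\<^sup>n\<close>. Hence \<open>\<parallel>\<chi>\<parallel>\<^sub>\<rho>\<close> is dominated by the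
  weighted sum, with no need for the Kunze-Stein phenomenon.
\<close>

section \<open>Young's inequality\<close>

text \<open>The tangent of \<open>ln\<close> at the weighted mean \<open>M\<close> lies above
  \<open>ln\<close>. Averaging the tangent bounds at \<open>a\<close>, \<open>b\<close>,
  \<open>c\<close> gives exactly \<open>ln M\<close>, because the linear terms cancel.\<close>

lemma weighted_arith_geo_mean3:
  fixes a b c :: real
  assumes "0 \<le> \<alpha>" "0 \<le> \<beta>" "0 \<le> \<gamma>" and sum: "\<alpha> + \<beta> + \<gamma> = 1" and "0 < a" "0 < b" "0 < c"
  shows "a powr \<alpha> * b powr \<beta> * c powr \<gamma> \<le> \<alpha> * a + \<beta> * b + \<gamma> * c"
proof -
  define M where "M = \<alpha> * a + \<beta> * b + \<gamma> * c"
  have nonneg: "0 \<le> \<alpha> * a" "0 \<le> \<beta> * b" "0 \<le> \<gamma> * c" using assms by auto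
  have "0 < \<alpha> \<or> 0 < \<beta> \<or> 0 < \<gamma>" using sum assms(1-3) by linarith
  then have "0 < \<alpha> * a \<or> 0 < \<beta> * b \<or> 0 < \<gamma> * c" using assms(5-7) by (metis mult_pos_pos)
  then have M: "0 < M" unfolding M_def using nonneg by linarith
  have ln_le: "t * ln x \<le> t * (ln M + x / M - 1)" if "0 \<le> t" "0 < x" for t x
  proof -
    have "ln x - ln M \<le> x / M - 1"
      using that M ln_le_minus_one[of "x / M"] by (simp add: ln_div)
    then have "ln x \<le> ln M + x / M - 1" by linarith
    then show ?thesis using that(1) by (rule mult_left_mono)
  qed
  have "\<alpha> * ln a + \<beta> * ln b + \<gamma> * ln c
      \<le> \<alpha> * (ln M + a / M - 1) + \<beta> * (ln M + b / M - 1) + \<gamma> * (ln M + c / M - 1)"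
    by (intro add_mono ln_le assms)
  also have "\<dots> = (\<alpha> + \<beta> + \<gamma>) * (ln M - 1) + (\<alpha> * a + \<beta> * b + \<gamma> * c) / M"
    by (simp add: algebra_simps add_divide_distrib)
  also have "\<dots> = ln M" using M sum by (simp flip: M_def)
  finally have "exp (\<alpha> * ln a + \<beta> * ln b + \<gamma> * ln c) \<le> M" using M by (simp add: ln_ge_iff)
  then show ?thesis using assms by (simp add: powr_def exp_add M_def)
qed

text \<open>After each factor is divided by its total \<open>U\<close>, \<open>V\<close>,
  \<open>W\<close>, the weighted mean inequality applies term by term, and the right-hand sides add
  up to \<open>\<alpha> + \<beta> + \<gamma> = 1\<close>.\<close>

lemma Holder_inequality_sum3:
  fixes u v w :: "'i \<Rightarrow> real"
  assumes S: "finite S" and exps: "0 \<le> \<alpha>" "0 \<le> \<beta>" "0 \<le> \<gamma>" "\<alpha> + \<beta> + \<gamma> = 1"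
    and nonneg: "\<And>i. i \<in> S \<Longrightarrow> 0 \<le> u i" "\<And>i. i \<in> S \<Longrightarrow> 0 \<le> v i" "\<And>i. i \<in> S \<Longrightarrow> 0 \<le> w i"
  shows "(\<Sum>i\<in>S. u i powr \<alpha> * v i powr \<beta> * w i powr \<gamma>)
    \<le> sum u S powr \<alpha> * sum v S powr \<beta> * sum w S powr \<gamma>"
proof (cases "sum u S = 0 \<or> sum v S = 0 \<or> sum w S = 0")
  case True
  then have "(\<forall>i\<in>S. u i = 0) \<or> (\<forall>i\<in>S. v i = 0) \<or> (\<forall>i\<in>S. w i = 0)"
    using S nonneg by (simp add: sum_nonneg_eq_0_iff)
  \<comment> \<open>Here \<open>0 powr x = 0\<close> holds for every exponent, including 0, so a
    factor that vanishes identically kills every term.\<close>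
  then have "(\<Sum>i\<in>S. u i powr \<alpha> * v i powr \<beta> * w i powr \<gamma>) = 0"
    by (intro sum.neutral) auto
  then show ?thesis by simp
next
  case False
  define U V W where "U = sum u S" and "V = sum v S" and "W = sum w S"
  have "0 \<le> U" "0 \<le> V" "0 \<le> W"
    unfolding U_def V_def W_def by (intro sum_nonneg nonneg; assumption)+
  then have pos: "0 < U" "0 < V" "0 < W"
    using False unfolding U_def V_def W_def by linarith+
  define K where "K = U powr \<alpha> * V powr \<beta> * W powr \<gamma>"
  have "u i powr \<alpha> * v i powr \<beta> * w i powr \<gamma>
      \<le> K * (\<alpha> * (u i / U) + \<beta> * (v i / V) + \<gamma> * (w i / W))" (is "_ \<le> K * ?M") if i: "i \<in> S" for i
  proof (cases "u i = 0 \<or> v i = 0 \<or> w i = 0")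
    case True
    moreover have "0 \<le> K * ?M"
      using nonneg i exps pos unfolding K_def by (intro mult_nonneg_nonneg add_nonneg_nonneg) auto
    ultimately show ?thesis by auto
  next
    case False
    then have uvw: "0 < u i" "0 < v i" "0 < w i" using nonneg[OF i] by auto
    have "u i powr \<alpha> * v i powr \<beta> * w i powr \<gamma>
        = K * ((u i / U) powr \<alpha> * (v i / V) powr \<beta> * (w i / W) powr \<gamma>)"
      using uvw pos by (simp add: K_def powr_divide)
    also have "\<dots> \<le> K * ?M"
      using uvw pos exps unfolding K_def
      by (intro mult_left_mono weighted_arith_geo_mean3) auto
    finally show ?thesis .
  qed
  then have "(\<Sum>i\<in>S. u i powr \<alpha> * v i powr \<beta> * w i powr \<gamma>)
      \<le> (\<Sum>i\<in>S. K * (\<alpha> * (u i / U) + \<beta> * (v i / V) + \<gamma> * (w i / W)))"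
    by (rule sum_mono)
  also have "\<dots> = K * (\<alpha> * (U / U) + \<beta> * (V / V) + \<gamma> * (W / W))"
    by (simp add: U_def V_def W_def sum.distrib flip: sum_distrib_left sum_divide_distrib)
  also have "\<dots> = K" using pos exps by simp
  finally show ?thesis unfolding K_def U_def V_def W_def .
qed

text \<open>The product \<open>f y * g y x\<close> is split into powers of
  \<open>f y powr a * g y x powr b\<close>, \<open>f y powr a\<close> and
  \<open>g y x powr b\<close>. Hoelder in \<open>y\<close> leaves the last factor to the row bound;
  after summation over \<open>x\<close>, the first one is controlled by the column bound. The kernel
  form asks for no group structure, only for rows and columns bounded by the same
  \<open>H\<close>.\<close>

lemma Young_inequality_kernel:
  fixes f :: "'i \<Rightarrow> real" and g :: "'i \<Rightarrow> 'j \<Rightarrow> real"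
  assumes Y: "finite Y" and X: "finite X" and f: "\<And>y. 0 \<le> f y" and g: "\<And>y x. 0 \<le> g y x"
    and exps: "1 \<le> a" "1 \<le> b" "1 \<le> p" "1 / a + 1 / b = 1 + 1 / p"
    and H: "0 \<le> H"
    and row: "\<And>x. x \<in> X \<Longrightarrow> (\<Sum>y\<in>Y. g y x powr b) \<le> H"
    and col: "\<And>y. y \<in> Y \<Longrightarrow> (\<Sum>x\<in>X. g y x powr b) \<le> H"
  shows "(\<Sum>x\<in>X. (\<Sum>y\<in>Y. f y * g y x) powr p) \<le> (\<Sum>y\<in>Y. f y powr a) powr (p / a) * H powr (p / b)"
proof -
  define F where "F = (\<Sum>y\<in>Y. f y powr a)"
  define N where "N = (\<lambda>x. \<Sum>y\<in>Y. f y powr a * g y x powr b)"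
  \<comment> \<open>By the relation between the exponents, \<open>\<beta> = 1 - 1 / b\<close> and
    \<open>\<gamma> = 1 - 1 / a\<close>, so both are nonnegative, and together with
    \<open>1 / p\<close> they sum to 1.\<close>
  define \<beta> \<gamma> where "\<beta> = 1 / a - 1 / p" and "\<gamma> = 1 / b - 1 / p"
  have F: "0 \<le> F" unfolding F_def by (intro sum_nonneg) auto
  have "1 / b \<le> 1" "1 / a \<le> 1" using exps by simp_all
  then have bg: "0 \<le> \<beta>" "0 \<le> \<gamma>" "1 / p + \<beta> + \<gamma> = 1"
    using exps(4) unfolding \<beta>_def \<gamma>_def by linarith+
  have split: "f y * g y x
      = (f y powr a * g y x powr b) powr (1 / p) * (f y powr a) powr \<beta> * (g y x powr b) powr \<gamma>" for x y
  proof (cases "f y = 0 \<or> g y x = 0")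
    case False
    then have pos: "0 < f y" "0 < g y x" using f[of y] g[of y x] by auto
    have "a * (1 / p) + a * \<beta> = 1" "b * (1 / p) + b * \<gamma> = 1"
      using exps unfolding \<beta>_def \<gamma>_def by (simp_all add: field_simps)
    then have "f y powr (a * (1 / p)) * f y powr (a * \<beta>) = f y"
      "g y x powr (b * (1 / p)) * g y x powr (b * \<gamma>) = g y x"
      using pos by (metis less_imp_le powr_add powr_one)+
    then have "f y * g y x = (f y powr (a * (1 / p)) * f y powr (a * \<beta>))
        * (g y x powr (b * (1 / p)) * g y x powr (b * \<gamma>))" by simp
    then show ?thesis
      by (simp only: powr_mult powr_powr mult_ac)
  qed (use exps in auto)
  have le: "(\<Sum>y\<in>Y. f y * g y x) powr p \<le> N x * (F powr (p / a - 1) * H powr (p / b - 1))"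
    if x: "x \<in> X" for x
  proof -
    have "(\<Sum>y\<in>Y. f y * g y x) \<le> N x powr (1 / p) * F powr \<beta> * (\<Sum>y\<in>Y. g y x powr b) powr \<gamma>"
      unfolding split N_def F_def using Y bg exps by (intro Holder_inequality_sum3) auto
    also have "\<dots> \<le> N x powr (1 / p) * F powr \<beta> * H powr \<gamma>"
      using row[OF x] bg by (intro mult_left_mono powr_mono2 sum_nonneg) auto
    finally have "(\<Sum>y\<in>Y. f y * g y x) powr p \<le> (N x powr (1 / p) * F powr \<beta> * H powr \<gamma>) powr p"
      using exps f g by (intro powr_mono2 sum_nonneg) auto
    also have "\<dots> = N x powr (1 / p * p) * (F powr (\<beta> * p) * H powr (\<gamma> * p))"
      by (simp only: powr_mult powr_powr mult_ac)
    also have "1 / p * p = 1"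
      using exps by simp
    also have "\<beta> * p = p / a - 1"
      using exps unfolding \<beta>_def by (simp add: field_simps)
    also have "\<gamma> * p = p / b - 1"
      using exps unfolding \<gamma>_def by (simp add: field_simps)
    also have "N x powr 1 = N x"
      using f g unfolding N_def by (intro powr_one sum_nonneg) auto
    finally show ?thesis .
  qed
  have "(\<Sum>x\<in>X. N x) = (\<Sum>y\<in>Y. f y powr a * (\<Sum>x\<in>X. g y x powr b))"
    unfolding N_def by (subst sum.swap) (simp add: sum_distrib_left)
  also have "\<dots> \<le> (\<Sum>y\<in>Y. f y powr a * H)"
    using col by (intro sum_mono mult_left_mono) auto
  also have "\<dots> = F * H" by (simp add: F_def sum_distrib_right)
  finally have N: "(\<Sum>x\<in>X. N x) \<le> F * H" .
  have "(\<Sum>x\<in>X. (\<Sum>y\<in>Y. f y * g y x) powr p)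
      \<le> (\<Sum>x\<in>X. N x * (F powr (p / a - 1) * H powr (p / b - 1)))"
    by (rule sum_mono) (rule le)
  also have "\<dots> = (\<Sum>x\<in>X. N x) * (F powr (p / a - 1) * H powr (p / b - 1))"
    by (simp add: sum_distrib_right)
  also have "\<dots> \<le> F * H * (F powr (p / a - 1) * H powr (p / b - 1))"
    using N by (rule mult_right_mono) simp
  also have "\<dots> = (F * F powr (p / a - 1)) * (H * H powr (p / b - 1))" by simp
  also have "\<dots> = F powr (p / a) * H powr (p / b)"
    using F H by (simp add: powr_mult_base)
  finally show ?thesis unfolding F_def .
qed

section \<open>Finitely supported functions\<close>

text \<open>An injective \<open>t\<close> meets each vertex at most once, and vertices off the
  support contribute 0. This bounds rows and columns of the convolution kernel, and \<open>f\<close>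
  along the orbit of the origin.\<close>

lemma sum_reindex_le_support:
  fixes h :: "'a \<Rightarrow> complex"
  assumes "finite_support V h" "inj_on t A" "t ` A \<subseteq> V" "finite A"
  shows "(\<Sum>a\<in>A. norm (h (t a)) powr b) \<le> (\<Sum>v | v \<in> V \<and> h v \<noteq> 0. norm (h v) powr b)"
proof -
  have "(\<Sum>a\<in>A. norm (h (t a)) powr b) = (\<Sum>v\<in>t ` A. norm (h v) powr b)"
    using assms(2) by (simp add: sum.reindex)
  also have "\<dots> = (\<Sum>v\<in>t ` A \<inter> {v \<in> V. h v \<noteq> 0}. norm (h v) powr b)"
    using assms by (intro sum.mono_neutral_right) auto
  also have "\<dots> \<le> (\<Sum>v | v \<in> V \<and> h v \<noteq> 0. norm (h v) powr b)"
    using assms by (intro sum_mono2) (auto simp: finite_support_def)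
  finally show ?thesis .
qed

lemma Lp_norm_finite_support:
  assumes "finite_support V f" and "0 < p"
  shows "Lp_norm V p f = (\<Sum>v | v \<in> V \<and> f v \<noteq> 0. norm (f v) powr p) powr (1 / p)"
proof -
  have "{a \<in> V. norm (f a) powr p \<noteq> 0} = {v \<in> V. f v \<noteq> 0}" using assms by auto
  then show ?thesis
    using assms unfolding Lp_norm_def finite_support_def
    by (subst lebesgue_integral_count_space_finite_support) auto
qed

section \<open>Spheres in a symmetric graph\<close>

context symmetric_graph
begin

section \<open>Polygons, their vertices and walks inside them\<close>

lemma polygonE:
  assumes "P \<in> polygons k"
  obtains c u where "P = set c \<union> (set c)\<inverse>" "awalk u c u" "c \<noteq> []" "distinct c" "length c = k"
  using assms unfolding polygons_def cycle_conv by blast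

lemma polygon_symmetric: "P \<in> polygons k \<Longrightarrow> (x, y) \<in> P \<longleftrightarrow> (y, x) \<in> P"
  by (elim polygonE) auto

lemma polygon_verts_snd: "P \<in> polygons k \<Longrightarrow> e \<in> P \<Longrightarrow> snd e \<in> polygon_verts P"
  using polygon_symmetric[of P "fst e" "snd e"] unfolding polygon_verts_def by force

lemma polygon_subset_arcs: "P \<in> polygons k \<Longrightarrow> P \<subseteq> parcs \<Gamma>"
  by (elim polygonE) (auto intro: arcs_symmetric)

lemma polygon_verts_subset: "P \<in> polygons k \<Longrightarrow> polygon_verts P \<subseteq> pverts \<Gamma>"
  unfolding polygon_verts_def using polygon_subset_arcs arc_fst_in_verts by blast

text \<open>A common arc yields a common vertex, namely its tail, and distinct polygons meeting at a
  vertex share no arc.\<close>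

lemma polygon_unique:
  assumes "P \<in> polygons k" "P' \<in> polygons k" "e \<in> P" "e \<in> P'"
  shows "P = P'"
  using polygons_meet[of P P' "fst e"] assms unfolding polygon_verts_def by blast

text \<open>The vertices of a walk are the tails followed by the last head, and also the first tail
  followed by the heads. For a closed walk the extra vertex is the same in both lists. It follows
  that every arc of a cycle has a successor in it.\<close>

lemma closed_walk_fst_eq_snd:
  assumes "awalk u c u"
  shows "fst ` set c = snd ` set c"
proof (cases "c = []")
  case False
  have *: "pawalk_verts u c = map fst c @ [snd (last c)]"
    using False awalk_verts_conv[of u c] by simp
  have **: "pawalk_verts u c = fst (hd c) # map snd c"
    using False assms awalk_verts_conv'[of u c u] by (auto elim: awalkE')
  have "fst (hd c) = snd (last c)"
    using assms * ** by (metis awhd_of_awalk awlast_of_awalk last_snoc list.sel(1) awalkE')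
  moreover have "set (map fst c @ [snd (last c)]) = set (fst (hd c) # map snd c)"
    using * ** by simp
  then have "insert (snd (last c)) (fst ` set c) = insert (fst (hd c)) (snd ` set c)"
    by simp
  moreover have "snd (last c) \<in> snd ` set c" "fst (hd c) \<in> fst ` set c"
    using False by auto
  ultimately show ?thesis by (metis insert_absorb)
qed simp

lemma polygon_verts_cycle:
  assumes "awalk u c u"
  shows "polygon_verts (set c \<union> (set c)\<inverse>) = fst ` set c"
  using closed_walk_fst_eq_snd[OF assms]
  by (simp add: polygon_verts_def image_Un fst_eq_Domain snd_eq_Range)

lemma polygon_verts_finite_card:
  assumes "P \<in> polygons k"
  shows "finite (polygon_verts P)" "card (polygon_verts P) \<le> k"
proof -
  obtain c u where c: "P = set c \<union> (set c)\<inverse>" "awalk u c u" "c \<noteq> []" "distinct c" "length c = k"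
    using assms by (rule polygonE)
  then have "polygon_verts P = set (map fst c)"
    using polygon_verts_cycle by simp
  then show "finite (polygon_verts P)" "card (polygon_verts P) \<le> k"
    using c(5) card_length[of "map fst c"] by auto
qed

text \<open>Initial segments of the cycle lead from its base point to \<open>x\<close> and to
  \<open>y\<close>. The first one reversed, then the second one, stays in \<open>P\<close> because
  \<open>P\<close> is closed under reversal.\<close>

lemma walk_in_polygon:
  assumes "P \<in> polygons k" "x \<in> polygon_verts P" "y \<in> polygon_verts P"
  obtains p where "awalk x p y" "set p \<subseteq> P"
proof -
  obtain c u where c: "P = set c \<union> (set c)\<inverse>" "awalk u c u" "c \<noteq> []" "distinct c" "length c = k"
    using assms(1) by (rule polygonE)
  have ex: "\<exists>q. awalk u q z \<and> set q \<subseteq> P" if z: "z \<in> polygon_verts P" for z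
  proof -
    have "z \<in> fst ` set c"
      using z c polygon_verts_cycle by simp
    then obtain b where "(z, b) \<in> set c" by auto
    then obtain q q' where "c = q @ (z, b) # q'"
      using split_list by metis
    then show ?thesis
      using c by (intro exI[of _ q]) (auto simp: awalk_Cons_iff)
  qed
  obtain q q' where q: "awalk u q x" "set q \<subseteq> P" "awalk u q' y" "set q' \<subseteq> P"
    using ex assms by blast
  have "set (rev_path q) = (set q)\<inverse>" by (induction q) auto
  then have "set (rev_path q) \<subseteq> P"
    using q polygon_symmetric[OF assms(1)] by auto
  moreover have "awalk x (rev_path q @ q') y"
    using q by (intro awalk_appendI[of _ _ u]) auto
  ultimately show ?thesis
    using q that[of "rev_path q @ q'"] by auto
qed

section \<open>The polygon distance\<close>

definition crossed :: "('a \<times> 'a) list \<Rightarrow> ('a \<times> 'a) set set" where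
  "crossed p = {P \<in> polygons k. P \<inter> set p \<noteq> {}}"

text \<open>Each of the finitely many arcs lies in at most one polygon. Finiteness matters because
  \<open>card\<close> of an infinite set is 0.\<close>

lemma finite_crossed: "finite (crossed p)"
proof -
  have "crossed p \<subseteq> (\<Union>e\<in>set p. {P \<in> polygons k. e \<in> P})"
    unfolding crossed_def by auto
  moreover have "finite {P \<in> polygons k. e \<in> P}" for e
  proof (cases "\<exists>P \<in> polygons k. e \<in> P")
    case True
    then obtain P where "P \<in> polygons k" "e \<in> P" by blast
    then have "{P \<in> polygons k. e \<in> P} \<subseteq> {P}"
      using polygon_unique by blast
    then show ?thesis by (rule finite_subset) simp
  next
    case False
    then have "{P \<in> polygons k. e \<in> P} = {}" by blast
    then show ?thesis by (metis finite.emptyI)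
  qed
  ultimately show ?thesis by (metis (no_types, lifting) finite_UN finite_set finite_subset)
qed

lemma polygon_dist_le: "awalk x p y \<Longrightarrow> polygon_dist k x y \<le> card (crossed p)"
  unfolding polygon_dist_def crossed_def by (rule Least_le) auto

text \<open>Connectedness supplies a walk from \<open>x\<close> to \<open>y\<close>, so the
  \<open>LEAST\<close> in the distance ranges over a nonempty set.\<close>

lemma polygon_dist_attained:
  assumes "x \<in> pverts \<Gamma>" "y \<in> pverts \<Gamma>"
  obtains p where "awalk x p y" "polygon_dist k x y = card (crossed p)"
proof -
  have "strongly_connected (with_proj \<Gamma>)"
    using connected symmetric_connected_imp_strongly_connected by blast
  then have "x \<rightarrow>\<^sup>*\<^bsub>with_proj \<Gamma>\<^esub> y"
    using assms unfolding strongly_connected_def by simp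
  then obtain p where "awalk x p y"
    unfolding reachable_awalk by blast
  then have "\<exists>n p. awalk x p y \<and> n = card (crossed p)" by blast
  from LeastI_ex[OF this] show ?thesis
    using that unfolding polygon_dist_def crossed_def by blast
qed

lemma polygon_dist_same: "x \<in> pverts \<Gamma> \<Longrightarrow> polygon_dist k x x = 0"
  using polygon_dist_le[of x "[]" x] by (simp add: awalk_Nil_iff crossed_def)

text \<open>A nonempty walk crosses at least the polygon that contains its first arc.\<close>

lemma polygon_dist_eq_0D:
  assumes "x \<in> pverts \<Gamma>" "y \<in> pverts \<Gamma>" "polygon_dist k x y = 0"
  shows "x = y"
proof -
  obtain p where p: "awalk x p y" "card (crossed p) = 0"
    using polygon_dist_attained assms by metis
  then have "crossed p = {}" using finite_crossed by simp
  moreover have "set p \<subseteq> parcs \<Gamma>" using p by (auto elim: awalkE')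
  ultimately have "p = []"
    using edge_polygon unfolding crossed_def by (cases p) fastforce+
  then show ?thesis using p by (simp add: awalk_Nil_iff)
qed

text \<open>A walk inside \<open>P\<close> from \<open>x\<close> to \<open>y\<close>, put in front
  of an optimal walk from \<open>y\<close>, adds at most the polygon \<open>P\<close> to those
  crossed.\<close>

lemma polygon_dist_step:
  assumes P: "P \<in> polygons k" "x \<in> polygon_verts P" "y \<in> polygon_verts P" and z: "z \<in> pverts \<Gamma>"
  shows "polygon_dist k x z \<le> Suc (polygon_dist k y z)"
proof -
  obtain q where q: "awalk x q y" "set q \<subseteq> P" using walk_in_polygon P .
  obtain p where p: "awalk y p z" "polygon_dist k y z = card (crossed p)"
    using polygon_dist_attained polygon_verts_subset P z by blast
  have "crossed (q @ p) \<subseteq> insert P (crossed p)"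
    using q(2) polygon_unique[OF _ P(1)] unfolding crossed_def by auto
  then have "card (crossed (q @ p)) \<le> Suc (card (crossed p))"
    using finite_crossed[of p] card_mono[of "insert P (crossed p)" "crossed (q @ p)"]
    by (auto simp: card_insert_if split: if_splits)
  moreover have "awalk x (q @ p) z" using q(1) p(1) by (rule awalk_appendI)
  ultimately show ?thesis using polygon_dist_le[of x "q @ p" z] p(2) by simp
qed

text \<open>Let \<open>P\<close> contain the first arc of an optimal walk, and let \<open>y\<close>
  be the point where the walk leaves \<open>P\<close> for the last time. The rest of the walk avoids
  \<open>P\<close> and so crosses at most \<open>n\<close> polygons;
  \<open>polygon_dist_step\<close> gives the opposite bound.\<close>

lemma polygon_dist_Suc_pred:
  assumes "x \<in> pverts \<Gamma>" "z \<in> pverts \<Gamma>" and n: "polygon_dist k x z = Suc n"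
  obtains P y where "P \<in> polygons k" "x \<in> polygon_verts P" "y \<in> polygon_verts P"
    "polygon_dist k y z = n"
proof -
  obtain p where p: "awalk x p z" "card (crossed p) = Suc n"
    using polygon_dist_attained[OF assms(1,2)] n by metis
  then obtain e es where e: "p = e # es" by (cases p) (auto simp: crossed_def)
  then have "e \<in> parcs \<Gamma>" "fst e = x" using p by (auto simp: awalk_Cons_iff)
  then obtain P where P: "P \<in> polygons k" "e \<in> P" using edge_polygon by blast
  obtain p1 a p2 where a: "p = p1 @ a # p2" "a \<in> P" "\<forall>b\<in>set p2. b \<notin> P"
    using split_list_last_prop[of p "\<lambda>b. b \<in> P"] e P by auto
  have x: "x \<in> polygon_verts P" using P \<open>fst e = x\<close> unfolding polygon_verts_def by auto
  have y: "snd a \<in> polygon_verts P" using polygon_verts_snd P a by blast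
  have "awalk (snd a) p2 z" using p a by (auto simp: awalk_Cons_iff)
  then have "polygon_dist k (snd a) z \<le> card (crossed p2)" by (rule polygon_dist_le)
  also have "crossed p2 \<subseteq> crossed p - {P}" using a unfolding crossed_def by auto
  then have "card (crossed p2) \<le> card (crossed p - {P})"
    using finite_crossed by (simp add: card_mono)
  also have "P \<in> crossed p" using a P unfolding crossed_def by auto
  then have "card (crossed p - {P}) = n" using p(2) by simp
  finally have "polygon_dist k (snd a) z = n"
    using polygon_dist_step[OF P(1) x y assms(2)] n by simp
  then show ?thesis using that P x y by blast
qed

section \<open>Size of the spheres\<close>

definition polygon_sphere :: "'a \<Rightarrow> nat \<Rightarrow> 'a set" where
  "polygon_sphere z n = {x \<in> pverts \<Gamma>. polygon_dist k x z = n}"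

text \<open>
  A flag of level \<open>n + 1\<close> continues a flag of level \<open>n\<close> through one of the \<open>r - 1\<close> other polygons to
  one of its \<open>k - 1\<close> other vertices. Counting flags instead of vertices makes it unnecessary to know
  that the polygon leading back towards \<open>z\<close> is unique.
\<close>

definition flags :: "'a \<Rightarrow> nat \<Rightarrow> ('a \<times> ('a \<times> 'a) set) set" where
  "flags z n = {(x, P). P \<in> polygons k \<and> x \<in> polygon_verts P \<and> polygon_dist k x z = Suc n
     \<and> (\<exists>y\<in>polygon_verts P. polygon_dist k y z = n)}"

lemma finite_polygons_at: "0 < r \<Longrightarrow> v \<in> pverts \<Gamma> \<Longrightarrow> finite {P \<in> polygons k. v \<in> polygon_verts P}"
  by (rule card_ge_0_finite) (simp add: card_polygons)

text \<open>Serves both the start and the inductive step of the count of flags: \<open>S\<close> is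
  the set of polygons through which \<open>y\<close> may be left.\<close>

lemma card_flags_from:
  assumes "finite S" "S \<subseteq> polygons k" "\<And>P. P \<in> S \<Longrightarrow> y \<in> polygon_verts P"
  defines "F \<equiv> (\<Union>P\<in>S. (\<lambda>x. (x, P)) ` (polygon_verts P - {y}))"
  shows "finite F" "card F \<le> card S * (k - 1)"
proof -
  have "card F \<le> (\<Sum>P\<in>S. card ((\<lambda>x. (x, P)) ` (polygon_verts P - {y})))"
    unfolding F_def using assms(1) by (rule card_UN_le)
  also have "\<dots> \<le> (\<Sum>P\<in>S. k - 1)"
  proof (rule sum_mono)
    fix P assume P: "P \<in> S"
    then have "P \<in> polygons k" "y \<in> polygon_verts P" using assms by auto
    then have "card (polygon_verts P - {y}) \<le> k - 1"
      using polygon_verts_finite_card[of P] by (simp add: card_Diff_singleton)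
    then show "card ((\<lambda>x. (x, P)) ` (polygon_verts P - {y})) \<le> k - 1"
      by (simp add: card_image inj_on_def)
  qed
  finally show "card F \<le> card S * (k - 1)" by simp
  show "finite F"
    unfolding F_def using assms polygon_verts_finite_card(1) by auto
qed

text \<open>At level 0 all \<open>r\<close> polygons at \<open>z\<close> are available; afterwards
  the polygon of the flag is excluded, which leaves \<open>r - 1\<close>. Each polygon offers at
  most \<open>k - 1\<close> further vertices.\<close>

lemma card_flags:
  assumes r: "0 < r" and z: "z \<in> pverts \<Gamma>"
  shows "finite (flags z n) \<and> card (flags z n) \<le> r * (k - 1) * ((r - 1) * (k - 1)) ^ n"
proof (induction n)
  case 0
  let ?S = "{P \<in> polygons k. z \<in> polygon_verts P}"
  let ?F = "\<Union>P\<in>?S. (\<lambda>x. (x, P)) ` (polygon_verts P - {z})"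
  have "y = z" if "P \<in> polygons k" "y \<in> polygon_verts P" "polygon_dist k y z = 0" for P y
    using that polygon_verts_subset polygon_dist_eq_0D z by blast
  then have sub: "flags z 0 \<subseteq> ?F"
    unfolding flags_def using polygon_dist_same[OF z] by fastforce
  have F: "finite ?F" "card ?F \<le> card ?S * (k - 1)"
    by (rule card_flags_from; use finite_polygons_at[OF r z] in blast)+
  have "card (flags z 0) \<le> r * (k - 1)"
    using card_mono[OF F(1) sub] F(2) unfolding card_polygons[OF z] by (rule le_trans)
  then show ?case
    using finite_subset[OF sub F(1)] by simp
next
  case (Suc n)
  define S where "S = (\<lambda>(y, P). {P' \<in> polygons k. y \<in> polygon_verts P'} - {P})"
  define F where "F = (\<lambda>f. \<Union>P'\<in>S f. (\<lambda>x. (x, P')) ` (polygon_verts P' - {fst f}))"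
  have F: "finite (F f) \<and> card (F f) \<le> (r - 1) * (k - 1)" if f: "f \<in> flags z n" for f
  proof -
    obtain y P where [simp]: "f = (y, P)" by (cases f)
    have P: "P \<in> polygons k" "y \<in> polygon_verts P" using f unfolding flags_def by auto
    then have y: "y \<in> pverts \<Gamma>" using polygon_verts_subset by blast
    have S: "S f = {P \<in> polygons k. y \<in> polygon_verts P} - {P}"
      unfolding S_def by simp
    have fin: "finite (S f)" unfolding S using finite_polygons_at[OF r y] by blast
    have card: "card (S f) = r - 1"
      unfolding S using P by (subst card_Diff_singleton) (auto simp: card_polygons[OF y])
    have "S f \<subseteq> polygons k" "\<And>P. P \<in> S f \<Longrightarrow> y \<in> polygon_verts P"
      unfolding S by auto
    note card_flags_from[OF fin this]
    then show ?thesis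
      unfolding F_def card by simp
  qed
  have sub: "flags z (Suc n) \<subseteq> (\<Union>f\<in>flags z n. F f)"
  proof
    fix g assume g: "g \<in> flags z (Suc n)"
    obtain x P' where [simp]: "g = (x, P')" by (cases g)
    obtain y where P': "P' \<in> polygons k" "x \<in> polygon_verts P'" "polygon_dist k x z = Suc (Suc n)"
      "y \<in> polygon_verts P'" "polygon_dist k y z = Suc n"
      using g unfolding flags_def by auto
    then have "y \<in> pverts \<Gamma>" using polygon_verts_subset by blast
    then obtain P w where P: "P \<in> polygons k" "y \<in> polygon_verts P" "w \<in> polygon_verts P"
      "polygon_dist k w z = n"
      using polygon_dist_Suc_pred z P'(5) by blast
    \<comment> \<open>The vertex \<open>w\<close> of \<open>P\<close> is at distance
      \<open>n\<close>, so all vertices of \<open>P\<close> are at distance at most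
      \<open>n + 1\<close>, while \<open>x\<close> is at distance \<open>n + 2\<close>.\<close>
    have "P' \<noteq> P"
      using polygon_dist_step[OF P(1) _ P(3) z, of x] P P' by auto
    moreover have "(y, P) \<in> flags z n" using P P' unfolding flags_def by auto
    moreover have "x \<noteq> y" using P' by auto
    ultimately show "g \<in> (\<Union>f\<in>flags z n. F f)"
      using P' unfolding F_def S_def by force
  qed
  have fin: "finite (\<Union>f\<in>flags z n. F f)" using Suc F by auto
  have "card (flags z (Suc n)) \<le> card (\<Union>f\<in>flags z n. F f)"
    using sub fin by (rule card_mono[rotated])
  also have "\<dots> \<le> (\<Sum>f\<in>flags z n. card (F f))"
    using Suc by (intro card_UN_le) auto
  also have "\<dots> \<le> card (flags z n) * ((r - 1) * (k - 1))"
    using sum_bounded_above[of "flags z n" "\<lambda>f. card (F f)"] F by auto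
  also have "\<dots> \<le> r * (k - 1) * ((r - 1) * (k - 1)) ^ n * ((r - 1) * (k - 1))"
    using Suc by (intro mult_right_mono) auto
  finally show ?case
    using finite_subset[OF sub fin] by (simp add: mult_ac)
qed

text \<open>Stepping back through one polygon shows that every vertex at distance
  \<open>m + 1\<close> is the first component of a flag of level \<open>m\<close>.\<close>

lemma card_polygon_sphere:
  assumes "2 \<le> k" "2 \<le> r" and z: "z \<in> pverts \<Gamma>"
  shows "finite (polygon_sphere z n)" "card (polygon_sphere z n) \<le> r * (k - 1) * ((r - 1) * (k - 1)) ^ n"
proof -
  have "finite (polygon_sphere z n) \<and> card (polygon_sphere z n) \<le> r * (k - 1) * ((r - 1) * (k - 1)) ^ n"
  proof (cases n)
    case 0
    have "polygon_sphere z 0 \<subseteq> {z}" unfolding polygon_sphere_def using polygon_dist_eq_0D z by blast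
    then have "finite (polygon_sphere z 0)" "card (polygon_sphere z 0) \<le> 1"
      using finite_subset card_mono[of "{z}"] by (auto simp: card_gt_0_iff)
    moreover have "1 * 1 \<le> r * (k - 1)" using assms by (intro mult_le_mono) auto
    ultimately show ?thesis using 0 by (simp del: One_nat_def)
  next
    case (Suc m)
    have sub: "polygon_sphere z n \<subseteq> fst ` flags z m"
    proof
      fix x
      assume "x \<in> polygon_sphere z n"
      then have x: "x \<in> pverts \<Gamma>" "polygon_dist k x z = Suc m"
        unfolding polygon_sphere_def Suc by auto
      obtain P y where "P \<in> polygons k" "x \<in> polygon_verts P" "y \<in> polygon_verts P"
        "polygon_dist k y z = m"
        using x(1) z x(2) by (rule polygon_dist_Suc_pred)
      then have "(x, P) \<in> flags z m" using x unfolding flags_def by auto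
      then show "x \<in> fst ` flags z m" by (metis fst_conv imageI)
    qed
    have fl: "finite (flags z m)" "card (flags z m) \<le> r * (k - 1) * ((r - 1) * (k - 1)) ^ m"
      using card_flags[of z m] assms by auto
    have "card (polygon_sphere z n) \<le> card (flags z m)"
      using fl(1) sub by (metis card_image_le card_mono finite_imageI le_trans)
    also note fl(2)
    \<comment> \<open>The base is at least 1, so the exponent \<open>m = n - 1\<close> coming from
      the flags may be raised to \<open>n\<close>. This gives one formula for all radii, including
      0.\<close>
    also have "((r - 1) * (k - 1)) ^ m \<le> ((r - 1) * (k - 1)) ^ n"
      using assms Suc by (intro power_increasing) auto
    finally show ?thesis using sub fl(1) by (auto intro: finite_subset)
  qed
  then show "finite (polygon_sphere z n)" "card (polygon_sphere z n) \<le> r * (k - 1) * ((r - 1) * (k - 1)) ^ n"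
    by auto
qed

section \<open>Infinitude of the graph and nonempty spheres\<close>

text \<open>
  In a finite graph, a walk that changes polygon at every step returns to one of its vertices; the
  first return gives a nontrivial loop through distinct vertices. Two consecutive sides of a polygon
  run through by the loop would have to be consecutive in the loop.
\<close>

lemma infinite_verts:
  assumes k: "2 \<le> k" and r: "2 \<le> r" and o: "orig \<in> pverts \<Gamma>"
  shows "infinite (pverts \<Gamma>)"
proof
  assume fin: "finite (pverts \<Gamma>)"
  have ex: "\<exists>P' e. P' \<in> polygons k \<and> P' \<noteq> P \<and> e \<in> P' \<and> fst e = v"
    if v: "v \<in> pverts \<Gamma>" for v P
  proof -
    have "finite {P \<in> polygons k. v \<in> polygon_verts P}"
      using finite_polygons_at[OF _ v] r by simp
    then have "card {P \<in> polygons k. v \<in> polygon_verts P} \<le> card {P}"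
      if "{P \<in> polygons k. v \<in> polygon_verts P} \<subseteq> {P}"
      using that by (intro card_mono) auto
    then obtain P' where "P' \<in> polygons k" "v \<in> polygon_verts P'" "P' \<noteq> P"
      using card_polygons[OF v] r by auto
    then show ?thesis unfolding polygon_verts_def by blast
  qed
  \<comment> \<open>Consecutive arcs are to lie in different polygons. This also rules out
    backtracking, since a polygon contains both directions of each of its sides.\<close>
  define turns where "turns = (\<lambda>e e'. fst e' = snd e \<and> (\<forall>P\<in>polygons k. e \<in> P \<longrightarrow> e' \<notin> P))"
  have "\<exists>e'. e' \<in> parcs \<Gamma> \<and> turns e e'" if e: "e \<in> parcs \<Gamma>" for e
  proof -
    obtain P where P: "P \<in> polygons k" "e \<in> P" using edge_polygon e by blast
    obtain P' e' where P': "P' \<in> polygons k" "P' \<noteq> P" "e' \<in> P'" "fst e' = snd e"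
      using ex arc_snd_in_verts[OF e] by metis
    have "turns e e'"
      unfolding turns_def using P P' polygon_unique by metis
    then show ?thesis using P' polygon_subset_arcs by blast
  qed
  moreover have "\<exists>e. e \<in> parcs \<Gamma>"
    using ex[OF o] polygon_subset_arcs by blast
  ultimately obtain e :: "nat \<Rightarrow> 'a \<times> 'a" where e: "\<And>n. e n \<in> parcs \<Gamma>" "\<And>n. turns (e n) (e (Suc n))"
    using dependent_nat_choice[of "\<lambda>_ e. e \<in> parcs \<Gamma>" "\<lambda>_. turns"] by metis
  define v where "v = (\<lambda>n. fst (e n))"
  have e_eq: "e n = (v n, v (Suc n))" for n
    using e(2)[of n] unfolding v_def turns_def by (simp add: prod_eq_iff)
  have v: "v n \<in> pverts \<Gamma>" for n
    unfolding v_def using e(1) arc_fst_in_verts by blast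
  have "\<not> inj v"
    using fin v by (meson finite_imageD finite_subset image_subsetI infinite_UNIV_nat)
  then obtain a b where "v a = v b" "a < b"
    unfolding inj_def by (metis linorder_neqE_nat)
  then have exj: "\<exists>j. \<exists>i<j. v i = v j" by blast
  define j where "j = (LEAST j. \<exists>i<j. v i = v j)"
  obtain i where i: "i < j" "v i = v j"
    using LeastI_ex[OF exj] unfolding j_def by blast
  have inj: "a = b" if "a < j" "b < j" "v a = v b" for a b
  proof -
    have "v i \<noteq> v b" if "b < j" "i < b" for i b
      using not_less_Least[OF that(1)[unfolded j_def]] that(2) by blast
    then show ?thesis using that by (metis linorder_neqE_nat)
  qed
  define p where "p = map e [i..<j]"
  have "awalk (v a) (map e [a..<b]) (v b)" if "a \<le> b" for a b
    using that
  proof (induction b rule: dec_induct)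
    case base
    show ?case using v by (simp add: awalk_Nil_iff)
  next
    case (step n)
    have "awalk (v n) [e n] (v (Suc n))"
      using e(1)[of n] v e_eq[of n] by (simp add: awalk_simps)
    then show ?case using step awalk_appendI by simp
  qed
  then have walk: "awalk (v i) p (v i)"
    unfolding p_def using i by (metis less_imp_le)
  have "e (Suc n) \<noteq> prod.swap (e n)" for n
  proof
    assume *: "e (Suc n) = prod.swap (e n)"
    obtain P where P: "P \<in> polygons k" "e n \<in> P" using edge_polygon e by blast
    then have "e (Suc n) \<in> P" using * e_eq[of n] polygon_symmetric[OF P(1)] by simp
    then show False using e(2)[of n] P unfolding turns_def by blast
  qed
  then have "nontrivial_loop p"
    unfolding nontrivial_loop_def using walk i by (auto simp: p_def successively_conv_nth)
  then obtain c where c: "cycle c" "length c = k" "set c \<subseteq> set p"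
    using loop_polygon by blast
  then obtain u where u: "awalk u c u" "distinct c" unfolding cycle_conv by blast
  define P where "P = set c \<union> (set c)\<inverse>"
  have P: "P \<in> polygons k" unfolding P_def polygons_def using c by blast
  \<comment> \<open>Nothing is known about the turn from the last arc \<open>e (j - 1)\<close> back
    to \<open>e i\<close>, so an arc of \<open>c\<close> other than \<open>e (j - 1)\<close> is
    chosen. It exists because \<open>c\<close> has \<open>k \<ge> 2\<close> distinct arcs.\<close>
  have "\<not> set c \<subseteq> {e (j - 1)}"
    using u(2) c(2) k card_mono[of "{e (j - 1)}" "set c"] by (auto simp: distinct_card)
  then obtain f where f: "f \<in> set c" "f \<noteq> e (j - 1)" by blast
  then obtain n where "f = e n" "n < j"
    using c(3) unfolding p_def by auto
  then have n: "e n \<in> set c" "n < j" "n \<noteq> j - 1"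
    using f by auto
  then have "Suc n < j" by simp
  \<comment> \<open>Some arc of \<open>c\<close> starts where \<open>e n\<close> ends. As
    \<open>v\<close> is injective below \<open>j\<close>, that arc can only be
    \<open>e (Suc n)\<close>, so two consecutive arcs lie in the same polygon.\<close>
  have "snd (e n) \<in> fst ` set c"
    using n closed_walk_fst_eq_snd[OF u(1)] by auto
  then obtain g where g: "g \<in> set c" "fst g = v (Suc n)"
    using e_eq[of n] by auto
  then obtain m where "g = e m" "m < j"
    using c(3) unfolding p_def by auto
  then have m: "e m \<in> set c" "m < j" "v m = v (Suc n)"
    using g unfolding v_def by auto
  then have "e (Suc n) \<in> P" using m inj[OF m(2) \<open>Suc n < j\<close> m(3)] unfolding P_def by blast
  moreover have "e n \<in> P" using n unfolding P_def by blast
  ultimately show False using e(2)[of n] P unfolding turns_def by blast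
qed

text \<open>Since the distance to \<open>z\<close> can be lowered by one step at a time, an empty
  sphere makes all larger ones empty. The vertex set would then be a finite union of finite
  spheres.\<close>

lemma polygon_sphere_nonempty:
  assumes "2 \<le> k" "2 \<le> r" and z: "z \<in> pverts \<Gamma>"
  shows "polygon_sphere z n \<noteq> {}"
proof
  assume empty: "polygon_sphere z n = {}"
  have "polygon_sphere z (n + m) = {}" for m
  proof (induction m)
    case (Suc m)
    show ?case
    proof (rule ccontr)
      assume "polygon_sphere z (n + Suc m) \<noteq> {}"
      then obtain x where "x \<in> pverts \<Gamma>" "polygon_dist k x z = Suc (n + m)"
        unfolding polygon_sphere_def by auto
      then obtain P y where "P \<in> polygons k" "y \<in> polygon_verts P" "polygon_dist k y z = n + m"
        using polygon_dist_Suc_pred z by metis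
      then show False using Suc polygon_verts_subset unfolding polygon_sphere_def by blast
    qed
  qed (use empty in simp)
  then have "x \<in> (\<Union>m<n. polygon_sphere z m)" if "x \<in> pverts \<Gamma>" for x
    using that unfolding polygon_sphere_def
    by (cases "polygon_dist k x z < n") (force dest: le_Suc_ex simp: not_less)+
  then have "pverts \<Gamma> \<subseteq> (\<Union>m<n. polygon_sphere z m)" by blast
  moreover have "finite (\<Union>m<n. polygon_sphere z m)" using card_polygon_sphere(1)[OF assms] by blast
  ultimately show False
    using infinite_verts[OF assms] finite_subset by blast
qed

end

section \<open>Convolution with radial functions\<close>

context symmetric_graph
begin

section \<open>Norms of radial functions by summation over spheres\<close>

text \<open>A vertex on the sphere makes the \<open>SOME\<close> in \<open>radial_value\<close>
  meaningful, and radiality makes its choice irrelevant.\<close>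

lemma radial_value_eq:
  assumes "radial k orig h" "x \<in> polygon_sphere orig n"
  shows "radial_value k orig h n = h x"
proof -
  have "\<exists>x. x \<in> pverts \<Gamma> \<and> polygon_dist k x orig = n"
    using assms unfolding polygon_sphere_def by blast
  from someI_ex[OF this] show ?thesis
    using assms unfolding radial_def radial_value_def polygon_sphere_def by auto
qed

text \<open>
  Both \<open>radial_value\<close> and the series have a junk value if some sphere is empty, so the nonemptiness
  of all spheres is essential here.
\<close>

lemma sum_radial_le:
  fixes Q s :: real
  assumes k: "2 \<le> k" and r: "2 \<le> r" and o: "orig \<in> pverts \<Gamma>"
    and h: "finite_support (pverts \<Gamma>) h" "radial k orig h"
    and Q: "Q = (real r - 1) * (real k - 1)" and s: "0 \<le> s"
  shows "(\<Sum>v | v \<in> pverts \<Gamma> \<and> h v \<noteq> 0. norm (h v) powr \<rho>)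
    \<le> real (r * (k - 1)) * (\<Sum>n. norm (radial_value k orig h n) powr \<rho>
              * (1 + real n) powr (2 * s) * Q powr ((1 + s) * real n))"
proof -
  define B where "B = {v \<in> pverts \<Gamma>. h v \<noteq> 0}"
  define d where "d = (\<lambda>v. polygon_dist k v orig)"
  define c where "c = (\<lambda>n. norm (radial_value k orig h n) powr \<rho>)"
  define W where "W = (\<lambda>n. c n * (1 + real n) powr (2 * s) * Q powr ((1 + s) * real n))"
  have B: "finite B" using h unfolding B_def finite_support_def by simp
  have Q_nat: "Q = real ((r - 1) * (k - 1))" using k r Q by (simp add: of_nat_diff)
  have "1 * 1 \<le> (r - 1) * (k - 1)" using k r by (intro mult_le_mono) auto
  then have Q1: "1 \<le> Q" unfolding Q_nat by linarith
  have W: "c n * Q ^ n \<le> W n" for n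
  proof -
    have "1 powr (2 * s) \<le> (1 + real n) powr (2 * s)" using s by (intro powr_mono2) auto
    moreover have "Q ^ n = Q powr real n" using Q1 by (simp add: powr_realpow)
    moreover have "Q powr real n \<le> Q powr ((1 + s) * real n)"
      using Q1 s by (intro powr_mono) (auto simp: algebra_simps)
    ultimately have "1 * Q ^ n \<le> (1 + real n) powr (2 * s) * Q powr ((1 + s) * real n)"
      by (intro mult_mono) auto
    then have "c n * (1 * Q ^ n) \<le> c n * ((1 + real n) powr (2 * s) * Q powr ((1 + s) * real n))"
      unfolding c_def by (intro mult_left_mono) auto
    then show ?thesis unfolding W_def by (simp add: mult.assoc)
  qed
  \<comment> \<open>At a radius not attained on the support, \<open>h\<close> vanishes on a nonempty
    sphere. Hence the series has finitely many nonzero terms and \<open>suminf\<close> is a genuine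
    sum.\<close>
  have zero: "W n = 0" if "n \<notin> d ` B" for n
  proof -
    obtain x where x: "x \<in> polygon_sphere orig n" using polygon_sphere_nonempty[OF k r o] by blast
    then have "x \<notin> B" using that unfolding d_def polygon_sphere_def by auto
    then have "h x = 0" using x unfolding B_def polygon_sphere_def by auto
    then show ?thesis using radial_value_eq[OF h(2) x] unfolding W_def c_def by simp
  qed
  have "(\<Sum>v\<in>B. norm (h v) powr \<rho>) = (\<Sum>n\<in>d ` B. \<Sum>v | v \<in> B \<and> d v = n. norm (h v) powr \<rho>)"
    using B by (intro sum.group[symmetric]) auto
  also have "\<dots> \<le> (\<Sum>n\<in>d ` B. real (r * (k - 1)) * W n)"
  proof (rule sum_mono)
    fix n
    have sub: "{v \<in> B. d v = n} \<subseteq> polygon_sphere orig n"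
      unfolding B_def d_def polygon_sphere_def by auto
    have "norm (h v) powr \<rho> = c n" if "v \<in> B" "d v = n" for v
      using radial_value_eq[OF h(2), of v n] sub that unfolding c_def by auto
    then have "(\<Sum>v | v \<in> B \<and> d v = n. norm (h v) powr \<rho>) = real (card {v \<in> B. d v = n}) * c n"
      by simp
    also have "card {v \<in> B. d v = n} \<le> card (polygon_sphere orig n)"
      using sub card_polygon_sphere(1)[OF k r o] by (intro card_mono)
    then have "card {v \<in> B. d v = n} \<le> r * (k - 1) * ((r - 1) * (k - 1)) ^ n"
      using card_polygon_sphere(2)[OF k r o, of n] by (rule le_trans)
    then have "real (card {v \<in> B. d v = n}) \<le> real (r * (k - 1) * ((r - 1) * (k - 1)) ^ n)"
      by (simp only: of_nat_le_iff)
    then have "real (card {v \<in> B. d v = n}) * c n \<le> real (r * (k - 1)) * Q ^ n * c n"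
      unfolding Q_nat c_def by (intro mult_right_mono) (simp_all only: of_nat_mult of_nat_power powr_ge_zero)
    also have "\<dots> = real (r * (k - 1)) * (c n * Q ^ n)" by simp
    also have "\<dots> \<le> real (r * (k - 1)) * W n" using W by (intro mult_left_mono) auto
    finally show "(\<Sum>v | v \<in> B \<and> d v = n. norm (h v) powr \<rho>) \<le> real (r * (k - 1)) * W n" .
  qed
  also have "\<dots> = real (r * (k - 1)) * (\<Sum>n. W n)"
    using B zero by (subst suminf_finite[of "d ` B"]) (auto simp: sum_distrib_left)
  finally show ?thesis unfolding B_def W_def c_def .
qed

end

context symmetric_graph_group
begin

section \<open>Young's inequality for convolution on the group\<close>

lemma group: "group G"
  using group_hom group_hom.axioms(1) by blast

lemma inj_on_orbit_map: "x \<in> pverts \<Gamma> \<Longrightarrow> inj_on (\<lambda>g. \<phi> g x) (carrier G)"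
  using simply_transitive element_image by (intro inj_onI) metis

lemma inj_on_inv_orbit_map: "x \<in> pverts \<Gamma> \<Longrightarrow> inj_on (\<lambda>g. \<phi> (inv g) x) (carrier G)"
  using group.inv_inj[OF group] inj_on_orbit_map group.inv_closed[OF group]
  by (auto simp: inj_on_def)

text \<open>The orbit map of the origin sends \<open>Y\<close> injectively into the finite support
  of \<open>f\<close>, so the infinite sum has only finitely many nonzero terms.\<close>

lemma convolution_eq_sum:
  assumes o: "orig \<in> pverts \<Gamma>" and f: "finite_support (pverts \<Gamma>) f"
  defines "Y \<equiv> {y \<in> carrier G. f (\<phi> y orig) \<noteq> 0}"
  shows "finite Y" "convolution G \<phi> orig f h x = (\<Sum>y\<in>Y. f (\<phi> y orig) * h (\<phi> (inv y) x))"
proof -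
  have "(\<lambda>y. \<phi> y orig) ` Y \<subseteq> {x \<in> pverts \<Gamma>. f x \<noteq> 0}"
    unfolding Y_def using element_image o by auto
  moreover have "inj_on (\<lambda>y. \<phi> y orig) Y"
    using inj_on_orbit_map[OF o] unfolding Y_def by (rule inj_on_subset) auto
  ultimately show Y: "finite Y"
    using f unfolding finite_support_def by (meson finite_imageD finite_subset)
  have "convolution G \<phi> orig f h x = (\<Sum>\<^sub>\<infinity>y\<in>Y. f (\<phi> y orig) * h (\<phi> (inv y) x))"
    unfolding convolution_def Y_def by (rule infsum_cong_neutral) auto
  then show "convolution G \<phi> orig f h x = (\<Sum>y\<in>Y. f (\<phi> y orig) * h (\<phi> (inv y) x))"
    using Y by simp
qed

text \<open>The support is contained in the union of the translates of the support of
  \<open>h\<close> by the finitely many elements of \<open>Y\<close>.\<close>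

lemma finite_support_convolution:
  assumes o: "orig \<in> pverts \<Gamma>"
    and f: "finite_support (pverts \<Gamma>) f" and h: "finite_support (pverts \<Gamma>) h"
  shows "finite_support (pverts \<Gamma>) (convolution G \<phi> orig f h)"
proof -
  define Y where "Y = {y \<in> carrier G. f (\<phi> y orig) \<noteq> 0}"
  note conv = convolution_eq_sum[OF o f, folded Y_def]
  have "{x \<in> pverts \<Gamma>. convolution G \<phi> orig f h x \<noteq> 0} \<subseteq> (\<Union>y\<in>Y. \<phi> y ` {v \<in> pverts \<Gamma>. h v \<noteq> 0})"
  proof
    fix x assume x: "x \<in> {x \<in> pverts \<Gamma>. convolution G \<phi> orig f h x \<noteq> 0}"
    then have "(\<Sum>y\<in>Y. f (\<phi> y orig) * h (\<phi> (inv y) x)) \<noteq> 0" by (simp add: conv(2))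
    then obtain y where "y \<in> Y" "f (\<phi> y orig) * h (\<phi> (inv y) x) \<noteq> 0"
      by (rule sum.not_neutral_contains_not_neutral)
    then have y: "y \<in> Y" "h (\<phi> (inv y) x) \<noteq> 0" by simp_all
    then have yG: "y \<in> carrier G" unfolding Y_def by simp
    then have invG: "inv y \<in> carrier G" by (rule group.inv_closed[OF group])
    have x': "x \<in> pverts \<Gamma>" using x by simp
    have "\<phi> (inv y) x \<in> pverts \<Gamma>" using invG x' refl by (rule element_image)
    moreover have "\<phi> y (\<phi> (inv y) x) = x"
      using orbit_sym_aux[OF invG x' refl] group.inv_inv[OF group yG] by simp
    ultimately have "x \<in> \<phi> y ` {v \<in> pverts \<Gamma>. h v \<noteq> 0}"
      using y(2) by (intro image_eqI[of _ _ "\<phi> (inv y) x"]) auto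
    then show "x \<in> (\<Union>y\<in>Y. \<phi> y ` {v \<in> pverts \<Gamma>. h v \<noteq> 0})"
      using y(1) by blast
  qed
  then show ?thesis
    using conv(1) h unfolding finite_support_def by (auto intro: finite_subset)
qed

text \<open>The kernel is \<open>norm (h (\<phi> (inv y) x))\<close>. For fixed \<open>x\<close> it
  runs through values of \<open>h\<close> injectively in \<open>y\<close>, by simple transitivity
  and inversion; for fixed \<open>y\<close> injectively in \<open>x\<close>, because group elements
  act as bijections. So the same \<open>H\<close> bounds rows and columns.\<close>

lemma Young_convolution:
  assumes o: "orig \<in> pverts \<Gamma>"
    and f: "finite_support (pverts \<Gamma>) f" and h: "finite_support (pverts \<Gamma>) h"
    and exps: "1 \<le> a" "1 \<le> b" "1 \<le> p" "1 / a + 1 / b = 1 + 1 / p"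
  shows "Lp_norm (pverts \<Gamma>) p (convolution G \<phi> orig f h)
    \<le> Lp_norm (pverts \<Gamma>) a f * (\<Sum>v | v \<in> pverts \<Gamma> \<and> h v \<noteq> 0. norm (h v) powr b) powr (1 / b)"
proof -
  define Y where "Y = {y \<in> carrier G. f (\<phi> y orig) \<noteq> 0}"
  note conv = convolution_eq_sum[OF o f, folded Y_def]
  define F where "F = convolution G \<phi> orig f h"
  define X where "X = {x \<in> pverts \<Gamma>. F x \<noteq> 0}"
  define H where "H = (\<Sum>v | v \<in> pverts \<Gamma> \<and> h v \<noteq> 0. norm (h v) powr b)"
  define A where "A = (\<Sum>v | v \<in> pverts \<Gamma> \<and> f v \<noteq> 0. norm (f v) powr a)"
  have F: "finite_support (pverts \<Gamma>) F"
    unfolding F_def using o f h by (rule finite_support_convolution)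
  then have X: "finite X" unfolding X_def finite_support_def .
  have Y: "Y \<subseteq> carrier G" unfolding Y_def by auto
  have inv: "inv y \<in> carrier G" if "y \<in> Y" for y using that Y group.inv_closed[OF group] by blast
  have H0: "0 \<le> H" unfolding H_def by (intro sum_nonneg) auto
  have row: "(\<Sum>y\<in>Y. norm (h (\<phi> (inv y) x)) powr b) \<le> H" if "x \<in> X" for x
    unfolding H_def
  proof (rule sum_reindex_le_support[OF h _ _ conv(1)])
    have x: "x \<in> pverts \<Gamma>" using that unfolding X_def by simp
    show "inj_on (\<lambda>y. \<phi> (inv y) x) Y" using inj_on_inv_orbit_map[OF x] Y by (rule inj_on_subset)
    show "(\<lambda>y. \<phi> (inv y) x) ` Y \<subseteq> pverts \<Gamma>" using inv x element_image by auto
  qed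
  have col: "(\<Sum>x\<in>X. norm (h (\<phi> (inv y) x)) powr b) \<le> H" if "y \<in> Y" for y
    unfolding H_def
  proof (rule sum_reindex_le_support[OF h _ _ X])
    have XV: "X \<subseteq> pverts \<Gamma>" unfolding X_def by auto
    show "inj_on (\<phi> (inv y)) X" using inj_prop[OF inv[OF that]] XV by (rule inj_on_subset)
    show "\<phi> (inv y) ` X \<subseteq> pverts \<Gamma>" using surj_prop[OF inv[OF that]] XV by blast
  qed
  have "(\<Sum>x\<in>X. norm (F x) powr p)
      \<le> (\<Sum>x\<in>X. (\<Sum>y\<in>Y. norm (f (\<phi> y orig)) * norm (h (\<phi> (inv y) x))) powr p)"
    unfolding F_def conv(2) using exps
    by (intro sum_mono powr_mono2 order_trans[OF norm_sum]) (auto simp: norm_mult)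
  also have "\<dots> \<le> (\<Sum>y\<in>Y. norm (f (\<phi> y orig)) powr a) powr (p / a) * H powr (p / b)"
    using conv(1) X exps H0 row col by (intro Young_inequality_kernel) auto
  also have "\<dots> \<le> A powr (p / a) * H powr (p / b)"
  proof (intro mult_right_mono powr_mono2)
    show "(\<Sum>y\<in>Y. norm (f (\<phi> y orig)) powr a) \<le> A"
      unfolding A_def
    proof (rule sum_reindex_le_support[OF f _ _ conv(1)])
      show "inj_on (\<lambda>y. \<phi> y orig) Y" using inj_on_orbit_map[OF o] Y by (rule inj_on_subset)
      show "(\<lambda>y. \<phi> y orig) ` Y \<subseteq> pverts \<Gamma>" using Y o element_image by auto
    qed
  qed (use exps in \<open>auto intro: sum_nonneg\<close>)
  finally have "(\<Sum>x\<in>X. norm (F x) powr p) powr (1 / p) \<le> (A powr (p / a) * H powr (p / b)) powr (1 / p)"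
    using exps by (intro powr_mono2 sum_nonneg) auto
  also have "\<dots> = A powr (1 / a) * H powr (1 / b)"
    using exps by (simp add: powr_mult powr_powr)
  finally show ?thesis
    using Lp_norm_finite_support[OF F, of p] Lp_norm_finite_support[OF f, of a] exps
    unfolding F_def X_def A_def H_def by simp
qed

end

section \<open>The weighted convolution estimate\<close>

theorem proposition3p11:
  fixes \<Gamma> :: "'a pair_pre_digraph" and k r :: nat
    and G :: "('g, 'm) monoid_scheme" and \<phi> :: "'g \<Rightarrow> 'a \<Rightarrow> 'a" and orig :: 'a
    and p q q' \<rho> s Q :: real
  assumes "k \<ge> 2" and "r \<ge> 2"
    and "symmetric_graph_group \<Gamma> k r G \<phi>"
    and "orig \<in> pverts \<Gamma>"
    and "Q = (real r - 1) * (real k - 1)"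
    and "2 \<le> p" and "2 \<le> q"
    and "1 / q + 1 / q' = 1"
    and "\<rho> = p * q / (p + q)"
    and "s = min p q / (p + q)"
  shows "\<exists>C>0. \<forall>f h.
    finite_support (pverts \<Gamma>) f \<longrightarrow>
    finite_support (pverts \<Gamma>) h \<longrightarrow> pair_pre_digraph.radial \<Gamma> k orig h \<longrightarrow>
      Lp_norm (pverts \<Gamma>) p (convolution G \<phi> orig f h)
      \<le> C * Lp_norm (pverts \<Gamma>) q' f *
        (\<Sum>n. norm (pair_pre_digraph.radial_value \<Gamma> k orig h n) powr \<rho>
              * (1 + real n) powr (2 * s) * Q powr ((1 + s) * real n)) powr (1 / \<rho>)"
proof -
  interpret symmetric_graph_group \<Gamma> k r G \<phi> by fact
  \<comment> \<open>With \<open>1 / q' = 1 - 1 / q\<close> this yields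
    \<open>1 / q' + 1 / \<rho> = 1 + 1 / p\<close>, the exponent relation in Young's inequality. The
    bounds \<open>2 \<le> p\<close> and \<open>2 \<le> q\<close> give
    \<open>1 \<le> \<rho>\<close>.\<close>
  have rho: "1 / \<rho> = 1 / p + 1 / q"
    using assms(6,7) unfolding assms(9) by (simp add: field_simps)
  also have "\<dots> \<le> 1 / 2 + 1 / 2" using assms by (intro add_mono divide_left_mono) auto
  finally have "1 / \<rho> \<le> 1" by simp
  moreover have "0 < \<rho>" using assms by simp
  ultimately have rho1: "1 \<le> \<rho>" by (simp add: field_simps)
  have q': "1 / q' = 1 - 1 / q" using assms by simp
  \<comment> \<open>Positivity of \<open>1 / q'\<close> excludes negative \<open>q'\<close> and also
    \<open>q' = 0\<close>, where \<open>1 / q'\<close> takes the default value 0.\<close>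
  moreover have "0 < 1 - 1 / q" using assms by simp
  ultimately have "0 < q'" by (metis zero_less_divide_1_iff)
  moreover have "1 / q' \<le> 1" unfolding q' using assms by simp
  ultimately have q'1: "1 \<le> q'" by (simp add: field_simps)
  have s: "0 \<le> s" using assms by simp
  \<comment> \<open>This is the factor in front of the power of \<open>Q\<close> in the bound for
    the spheres. The constant \<open>K powr (1 / \<rho>)\<close> depends only on \<open>k\<close>,
    \<open>r\<close>, \<open>p\<close> and \<open>q\<close>.\<close>
  define K where "K = real (r * (k - 1))"
  have K: "0 < K" unfolding K_def using assms by simp
  show ?thesis
  proof (intro exI[of _ "K powr (1 / \<rho>)"] conjI allI impI)
    show "0 < K powr (1 / \<rho>)" using K by simp
    fix f h
    assume f: "finite_support (pverts \<Gamma>) f" and h: "finite_support (pverts \<Gamma>) h" "radial k orig h"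
    define H where "H = (\<Sum>v | v \<in> pverts \<Gamma> \<and> h v \<noteq> 0. norm (h v) powr \<rho>)"
    define W where "W = (\<Sum>n. norm (radial_value k orig h n) powr \<rho>
              * (1 + real n) powr (2 * s) * Q powr ((1 + s) * real n))"
    have H: "H \<le> K * W"
      unfolding H_def W_def K_def using sum_radial_le[OF assms(1,2,4) h assms(5) s] .
    have "0 \<le> H" unfolding H_def by (intro sum_nonneg) auto
    have "Lp_norm (pverts \<Gamma>) p (convolution G \<phi> orig f h)
        \<le> Lp_norm (pverts \<Gamma>) q' f * H powr (1 / \<rho>)"
      unfolding H_def using assms(4) f h(1) q'1 rho1
      by (rule Young_convolution) (use assms q' rho in auto)
    also have "\<dots> \<le> Lp_norm (pverts \<Gamma>) q' f * (K * W) powr (1 / \<rho>)"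
      using H \<open>0 \<le> H\<close> rho1 by (intro mult_left_mono powr_mono2) (auto simp: Lp_norm_def)
    also have "\<dots> = K powr (1 / \<rho>) * Lp_norm (pverts \<Gamma>) q' f * W powr (1 / \<rho>)"
      by (simp add: powr_mult)
    finally show "Lp_norm (pverts \<Gamma>) p (convolution G \<phi> orig f h)
        \<le> K powr (1 / \<rho>) * Lp_norm (pverts \<Gamma>) q' f *
          (\<Sum>n. norm (radial_value k orig h n) powr \<rho>
              * (1 + real n) powr (2 * s) * Q powr ((1 + s) * real n)) powr (1 / \<rho>)"
      unfolding W_def .
  qed
qed

end
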